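(* Let $A\in\mathbb{R}_{\max}^{n\times n}$, $C\in\mathbb{R}_{\max}^{q\times n}$, let $\mathcal{V}\subset(\mathbb{R}_{\max}^n)^2$ be a congruence, and define $\mathcal{K}=\mathcal{V}^\top$. Then $\mathcal{K}^*(A^t,C^t)^\bot$ is the minimal (i.e. smallest) closed $(C,A)$-conditioned invariant congruence containing $\mathcal{V}$. Therefore $\mathcal{V}_*(C,A)\subset\mathcal{K}^*(A^t,C^t)^\bot$, and $\mathcal{V}_*(C,A)=\mathcal{K}^*(A^t,C^t)^\bot$ if $\mathcal{V}_*(C,A)$ is closed.
   Context: Max-plus semiring: $\mathbb{R}_{\max}=\mathbb{R}\cup\{-\infty\}$ with addition $a\oplus b=\max(a,b)$ and multiplication $ab=a+b$; the zero is $\varepsilon=-\infty$. Operations extend to matrices as usual: $(E\oplus F)_{ij}=E_{ij}\oplus F_{ij}$, $(EF)_{ij}=\bigoplus_k E_{ik}F_{kj}$; $E^t$ is the transpose. Topology: $\mathbb{R}_{\max}$ has the metric $d(a,b)=|\exp(a)-\exp(b)|$, and $\mathbb{R}_{\max}^n$ the product topology. A semimodule is a (nonempty) subset of $\mathbb{R}_{\max}^n$ stable under all max-plus linear combinations $\lambda x\oplus\mu y$. A congruence on $\mathbb{R}_{\max}^n$ is an equivalence relation $\mathcal{W}\subset(\mathbb{R}_{\max}^n)^2$ which is also a subsemimodule of $(\mathbb{R}_{\max}^n)^2$. For a matrix $E$, $\operatorname{Im}E=\{Ex\}$ and $\ker E=\{(x,y): Ex=Ey\}$. $A\mathcal{W}=\{(Ax,Ay):(x,y)\in\mathcal{W}\}$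 for a congruence; $\mathcal{X}\oplus\mathcal{Y}=\{x\oplus y: x\in\mathcal{X},y\in\mathcal{Y}\}$. A congruence $\mathcal{W}$ is $(C,A)$-conditioned invariant if $A(\mathcal{W}\cap\ker C)\subset\mathcal{W}$. $\mathcal{V}_*(C,A)$ denotes the smallest $(C,A)$-conditioned invariant congruence containing $\mathcal{V}$ (it exists, since such congruences are stable under intersection). A semimodule $\mathcal{X}\subset\mathbb{R}_{\max}^n$ is $(A,B)$-controlled invariant (for $B\in\mathbb{R}_{\max}^{n\times q}$) if $A\mathcal{X}\subset\mathcal{X}\oplus\operatorname{Im}B$. $\mathcal{K}^*(A,B)$ denotes the largest $(A,B)$-controlled invariant semimodule contained in the semimodule $\mathcal{K}$ (it exists, since such semimodules are stable under sums). Orthogonals: $\mathcal{X}^\bot=\{(x,y)\in(\mathbb{R}_{\max}^n)^2: x^tz=y^tz\ \forall z\in\mathcal{X}\}$ for a semimodule $\mathcal{X}$, and $\mathcal{W}^\top=\{z\in\mathbb{R}_{\max}^n: x^tz=y^tz\ \forall (x,y)\in\mathcal{W}\}$ for a congruence $\mathcal{W}$. *)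

theory Defs
  imports "HOL-Analysis.Analysis"
begin

section \<open>The max-plus semiring\<close>

typedef rmax = "{x :: ereal. x \<noteq> \<infinity>}"
  morphisms ereal_of_rmax Abs_rmax
  by (rule exI[of _ 0]) simp

setup_lifting type_definition_rmax

text \<open>The class operations on \<^typ>\<open>rmax\<close> are the max-plus ones: \<open>+\<close> is the maximum,
  \<open>*\<close> is the addition of extended reals, \<open>0\<close> is \<open>-\<infinity>\<close> and \<open>1\<close> is the real number zero.
  The library notions \<open>*v\<close>, \<open>*s\<close>, \<open>transpose\<close>, \<open>scalar_product\<close> and
  finite sums over \<^typ>\<open>rmax\<close> are thereby the max-plus ones.\<close>

instantiation rmax :: comm_semiring_1
begin

lift_definition zero_rmax :: rmax is "- \<infinity>" by simp
lift_definition one_rmax :: rmax is "0" by simp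
lift_definition plus_rmax :: "rmax \<Rightarrow> rmax \<Rightarrow> rmax" is max
  by (auto simp: max_def)
lift_definition times_rmax :: "rmax \<Rightarrow> rmax \<Rightarrow> rmax" is "(+)"
  by simp

instance
proof
  fix a b c :: rmax
  show "a + b + c = a + (b + c)" by transfer (simp add: max.assoc)
  show "a + b = b + a" by transfer (simp add: max.commute)
  show "0 + a = a" by transfer (simp add: max_def)
  show "a * b * c = a * (b * c)" by transfer (simp add: add.assoc)
  show "a * b = b * a" by transfer (simp add: add.commute)
  show "1 * a = a" by transfer simp
  show "0 * a = 0" by transfer simp
  show "a * 0 = 0" by transfer simp
  show "(a + b) * c = a * c + b * c"
  proof transfer
    fix a b c :: ereal
    have "mono (\<lambda>x. x + c)" by (intro monoI add_right_mono)
    then show "max a b + c = max (a + c) (b + c)" by (rule max_of_mono[symmetric])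
  qed
  show "(0::rmax) \<noteq> 1" by transfer simp
qed

end

lift_definition exp_rmax :: "rmax \<Rightarrow> real"
  is "\<lambda>x. if x = - \<infinity> then 0 else exp (real_of_ereal x)" .

lemma exp_rmax_inject: "exp_rmax a = exp_rmax b \<longleftrightarrow> a = b"
proof transfer
  fix a b :: ereal
  assume "a \<noteq> \<infinity>" "b \<noteq> \<infinity>"
  then show "((if a = - \<infinity> then 0 else exp (real_of_ereal a)) =
    (if b = - \<infinity> then 0 else exp (real_of_ereal b))) = (a = b)"
    by (cases a; cases b) auto
qed

instantiation rmax :: metric_space
begin

definition dist_rmax :: "rmax \<Rightarrow> rmax \<Rightarrow> real" where
  "dist_rmax a b = \<bar>exp_rmax a - exp_rmax b\<bar>"

definition uniformity_rmax :: "(rmax \<times> rmax) filter" where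
  "uniformity_rmax = (INF e\<in>{0<..}. principal {(x, y). dist x y < e})"

definition open_rmax :: "rmax set \<Rightarrow> bool" where
  "open_rmax U \<longleftrightarrow> (\<forall>x\<in>U. eventually (\<lambda>(x', y). x' = x \<longrightarrow> y \<in> U) uniformity)"

instance
  by standard
    (auto simp: dist_rmax_def uniformity_rmax_def open_rmax_def exp_rmax_inject)

end

section \<open>Semimodules and congruences\<close>

text \<open>The scalar action \<open>act\<close> is a parameter, so that the same notion applies to
  subsets of \<open>rmax ^ 'n\<close> and of \<open>(rmax ^ 'n) \<times> (rmax ^ 'n)\<close>.\<close>

definition subsemimodule :: "(rmax \<Rightarrow> 'v \<Rightarrow> 'v :: plus) \<Rightarrow> 'v set \<Rightarrow> bool" where
  "subsemimodule act X \<longleftrightarrow>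
     X \<noteq> {} \<and> (\<forall>a b. \<forall>x\<in>X. \<forall>y\<in>X. act a x + act b y \<in> X)"

definition smult_pair ::
    "rmax \<Rightarrow> (rmax ^ 'n) \<times> (rmax ^ 'n) \<Rightarrow> (rmax ^ 'n) \<times> (rmax ^ 'n)" where
  "smult_pair a = map_prod ((*s) a) ((*s) a)"

definition congruence :: "((rmax ^ 'n) \<times> (rmax ^ 'n)) set \<Rightarrow> bool" where
  "congruence W \<longleftrightarrow> equiv UNIV W \<and> subsemimodule smult_pair W"

definition mat_ker :: "rmax ^ 'n ^ 'm \<Rightarrow> ((rmax ^ 'n) \<times> (rmax ^ 'n)) set" where
  "mat_ker E = {(x, y). E *v x = E *v y}"

definition conditioned_invariant ::
    "rmax ^ 'n ^ 'q \<Rightarrow> rmax ^ 'n ^ 'n \<Rightarrow> ((rmax ^ 'n) \<times> (rmax ^ 'n)) set \<Rightarrow> bool" where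
  "conditioned_invariant C A W \<longleftrightarrow>
     congruence W \<and> map_prod ((*v) A) ((*v) A) ` (W \<inter> mat_ker C) \<subseteq> W"

definition min_conditioned_invariant ::
    "((rmax ^ 'n) \<times> (rmax ^ 'n)) set \<Rightarrow> rmax ^ 'n ^ 'q \<Rightarrow> rmax ^ 'n ^ 'n \<Rightarrow>
       ((rmax ^ 'n) \<times> (rmax ^ 'n)) set" where
  "min_conditioned_invariant V C A = (LEAST W. conditioned_invariant C A W \<and> V \<subseteq> W)"

text \<open>The sum of sets is the elementwise one, \<open>X + Y = {x + y | x \<in> X, y \<in> Y}\<close>.\<close>

definition controlled_invariant ::
    "rmax ^ 'n ^ 'n \<Rightarrow> rmax ^ 'q ^ 'n \<Rightarrow> (rmax ^ 'n) set \<Rightarrow> bool" where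
  "controlled_invariant A B X \<longleftrightarrow>
     subsemimodule (*s) X \<and> (*v) A ` X \<subseteq> X + range ((*v) B)"

definition max_controlled_invariant ::
    "(rmax ^ 'n) set \<Rightarrow> rmax ^ 'n ^ 'n \<Rightarrow> rmax ^ 'q ^ 'n \<Rightarrow> (rmax ^ 'n) set" where
  "max_controlled_invariant K A B = (GREATEST X. controlled_invariant A B X \<and> X \<subseteq> K)"

definition semimodule_orth ::
    "(rmax ^ 'n) set \<Rightarrow> ((rmax ^ 'n) \<times> (rmax ^ 'n)) set" where
  "semimodule_orth X = {(x, y). \<forall>z\<in>X. scalar_product x z = scalar_product y z}"

definition congruence_orth ::
    "((rmax ^ 'n) \<times> (rmax ^ 'n)) set \<Rightarrow> (rmax ^ 'n) set" where
  "congruence_orth W = {z. \<forall>(x, y)\<in>W. scalar_product x z = scalar_product y z}"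

section \<open>Existence of the extremal invariant objects\<close>

lemma matrix_vector_mult_lincomb:
  fixes A :: "rmax ^ 'n ^ 'm"
  shows "A *v (a *s x + b *s y) = a *s (A *v x) + b *s (A *v y)"
  by (simp add: vec_eq_iff matrix_vector_mult_def sum.distrib sum_distrib_left
      distrib_left mult.left_commute)

lemma scalar_product_lincomb:
  fixes x y z :: "rmax ^ 'n"
  shows "scalar_product x (a *s y + b *s z) = a * scalar_product x y + b * scalar_product x z"
  by (simp add: scalar_product_def sum.distrib sum_distrib_left distrib_left mult.left_commute)

lemma subsemimodule_congruence_orth: "subsemimodule (*s) (congruence_orth W)"
proof -
  have "0 \<in> congruence_orth W"
    by (auto simp: congruence_orth_def scalar_product_def)
  moreover have "a *s x + b *s y \<in> congruence_orth W"
    if "x \<in> congruence_orth W" "y \<in> congruence_orth W" for a b x y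
    using that by (fastforce simp: congruence_orth_def scalar_product_lincomb)
  ultimately show ?thesis
    by (auto simp: subsemimodule_def)
qed

lemma conditioned_invariant_Inter:
  assumes "\<W> \<noteq> {}" and "\<And>W. W \<in> \<W> \<Longrightarrow> conditioned_invariant C A W"
  shows "conditioned_invariant C A (\<Inter>\<W>)"
proof -
  have eq: "equiv UNIV W" and sub: "subsemimodule smult_pair W"
    and inv: "map_prod ((*v) A) ((*v) A) ` (W \<inter> mat_ker C) \<subseteq> W" if "W \<in> \<W>" for W
    using assms(2)[OF that] by (auto simp: conditioned_invariant_def congruence_def)
  have refl: "(x, x) \<in> \<Inter>\<W>" for x
    using eq by (auto simp: equiv_def refl_on_def)
  have "equiv UNIV (\<Inter>\<W>)"
  proof (rule equivI)
    show "refl (\<Inter>\<W>)" using refl by (simp add: refl_on_def)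
    show "sym (\<Inter>\<W>)" using eq by (fastforce simp: equiv_def intro!: symI dest: symD)
    show "trans (\<Inter>\<W>)" using eq by (fastforce simp: equiv_def intro!: transI dest: transD)
  qed simp
  moreover have "subsemimodule smult_pair (\<Inter>\<W>)"
    using sub refl unfolding subsemimodule_def by blast
  moreover have "map_prod ((*v) A) ((*v) A) ` (\<Inter>\<W> \<inter> mat_ker C) \<subseteq> \<Inter>\<W>"
    using inv by blast
  ultimately show ?thesis
    by (simp add: conditioned_invariant_def congruence_def)
qed

lemma min_conditioned_invariant:
  shows min_conditioned_invariant_invariant:
      "conditioned_invariant C A (min_conditioned_invariant V C A)"
    and min_conditioned_invariant_superset: "V \<subseteq> min_conditioned_invariant V C A"
    and min_conditioned_invariant_least:
      "conditioned_invariant C A W \<Longrightarrow> V \<subseteq> W \<Longrightarrow> min_conditioned_invariant V C A \<subseteq> W"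
proof -
  let ?\<W> = "{W. conditioned_invariant C A W \<and> V \<subseteq> W}"
  have "UNIV \<in> ?\<W>"
    by (auto simp: conditioned_invariant_def congruence_def subsemimodule_def
        equiv_def refl_on_def sym_def trans_def)
  then have inv: "conditioned_invariant C A (\<Inter>?\<W>)"
    by (intro conditioned_invariant_Inter) auto
  have eq: "min_conditioned_invariant V C A = \<Inter>?\<W>"
    unfolding min_conditioned_invariant_def by (rule Least_equality) (use inv in auto)
  show "conditioned_invariant C A (min_conditioned_invariant V C A)"
    and "V \<subseteq> min_conditioned_invariant V C A"
    using inv by (auto simp: eq)
  show "min_conditioned_invariant V C A \<subseteq> W" if "conditioned_invariant C A W" "V \<subseteq> W"
    using that by (auto simp: eq)
qed

inductive_set semimodule_span :: "(rmax ^ 'n) set \<Rightarrow> (rmax ^ 'n) set"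
  for X :: "(rmax ^ 'n) set" where
  base: "x \<in> X \<Longrightarrow> x \<in> semimodule_span X"
| lincomb: "x \<in> semimodule_span X \<Longrightarrow> y \<in> semimodule_span X \<Longrightarrow>
    a *s x + b *s y \<in> semimodule_span X"

lemma controlled_invariant_span_Union:
  assumes "\<X> \<noteq> {}" and "\<And>X. X \<in> \<X> \<Longrightarrow> controlled_invariant A B X"
  shows "controlled_invariant A B (semimodule_span (\<Union>\<X>))"
proof -
  let ?S = "semimodule_span (\<Union>\<X>)"
  have "\<exists>s\<in>?S. \<exists>u. A *v x = s + B *v u" if "x \<in> ?S" for x
    using that
  proof (induction x rule: semimodule_span.induct)
    case (base x)
    then obtain X where X: "X \<in> \<X>" "x \<in> X" by blast
    then have "A *v x \<in> X + range ((*v) B)"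
      using assms(2)[OF X(1)] by (auto simp: controlled_invariant_def)
    then show ?case
      using X(1) by (auto simp: set_plus_def intro!: bexI semimodule_span.base)
  next
    case (lincomb x y a b)
    then obtain s t u v where st: "s \<in> ?S" "t \<in> ?S"
      and A: "A *v x = s + B *v u" "A *v y = t + B *v v" by blast
    have "A *v (a *s x + b *s y) = (a *s s + b *s t) + B *v (a *s u + b *s v)"
      by (simp add: matrix_vector_mult_lincomb A vec_eq_iff distrib_left ac_simps)
    then show ?case using st by (blast intro: semimodule_span.lincomb)
  qed
  then have "(*v) A ` ?S \<subseteq> ?S + range ((*v) B)"
    by (fastforce simp: set_plus_def)
  moreover have "?S \<noteq> {}"
  proof -
    obtain X where X: "X \<in> \<X>" using assms(1) by blast
    have "X \<noteq> {}"
      using assms(2)[OF X] by (simp add: controlled_invariant_def subsemimodule_def)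
    then obtain x where "x \<in> X" by blast
    with X show ?thesis by (blast intro: semimodule_span.base)
  qed
  ultimately show ?thesis
    by (auto simp: controlled_invariant_def subsemimodule_def intro: semimodule_span.lincomb)
qed

lemma max_controlled_invariant:
  assumes K: "subsemimodule (*s) K"
  shows max_controlled_invariant_invariant:
      "controlled_invariant A B (max_controlled_invariant K A B)"
    and max_controlled_invariant_subset: "max_controlled_invariant K A B \<subseteq> K"
    and max_controlled_invariant_greatest:
      "controlled_invariant A B X \<Longrightarrow> X \<subseteq> K \<Longrightarrow> X \<subseteq> max_controlled_invariant K A B"
proof -
  let ?\<X> = "{X. controlled_invariant A B X \<and> X \<subseteq> K}"
  let ?S = "semimodule_span (\<Union>?\<X>)"
  obtain k where k: "k \<in> K" using K by (auto simp: subsemimodule_def)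
  then have "0 *s k + 0 *s k \<in> K" using K unfolding subsemimodule_def by blast
  moreover have "0 *s k + 0 *s k = 0" by (simp add: vec_eq_iff)
  ultimately have "0 \<in> K" by simp
  moreover have "controlled_invariant A B {0}"
    by (auto simp: controlled_invariant_def subsemimodule_def set_plus_def vec_eq_iff
        matrix_vector_mult_def intro!: exI[of _ 0])
  ultimately have "{0} \<in> ?\<X>" by simp
  then have inv: "controlled_invariant A B ?S"
    by (intro controlled_invariant_span_Union) auto
  have "x \<in> K" if "x \<in> ?S" for x
    using that by (induction x rule: semimodule_span.induct) (use K in \<open>auto simp: subsemimodule_def\<close>)
  then have sub: "?S \<subseteq> K" by blast
  have great: "X \<subseteq> ?S" if "controlled_invariant A B X" "X \<subseteq> K" for X
    using that by (auto intro: semimodule_span.base)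
  have eq: "max_controlled_invariant K A B = ?S"
    unfolding max_controlled_invariant_def
    by (rule Greatest_equality) (use inv sub great in auto)
  show "controlled_invariant A B (max_controlled_invariant K A B)"
    and "max_controlled_invariant K A B \<subseteq> K"
    using inv sub by (simp_all add: eq)
  show "X \<subseteq> max_controlled_invariant K A B" if "controlled_invariant A B X" "X \<subseteq> K"
    using great[OF that] by (simp add: eq)
qed

end

theory Submission
  imports Defs
begin

text \<open>Everything rests on two separation results. A point \<open>s\<close> outside a closed semimodule \<open>X\<close>
  is separated from it by an inequality \<open>z $ i \<le> p * scalar_product v z\<close>, obtained after raising
  all coordinates of \<open>s\<close> slightly, so that they become invertible. A pair outside a closed
  congruence \<open>W\<close> is separated by the residuated functional sending \<open>x\<close> to the least \<open>l\<close> with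
  \<open>x\<close> below \<open>l *s t'\<close> modulo \<open>W\<close>; hence \<open>semimodule_orth (congruence_orth W) = W\<close>.
  If \<open>W\<close> is closed and conditioned invariant and \<open>z\<close> is orthogonal to \<open>W\<close>, then \<open>transpose A *v z\<close>
  lies in \<open>X = congruence_orth W + range ((*v) (transpose C))\<close>, which is closed: otherwise a pair
  separating it from \<open>X\<close> would lie in \<open>W \<inter> mat_ker C\<close>, contradicting the invariance of \<open>W\<close>.
  So \<open>congruence_orth W\<close> is controlled invariant, and minimality follows by taking
  orthogonals.\<close>

subsection \<open>Order and topology of the max-plus semiring\<close>

instantiation rmax :: linorder
begin

text \<open>\<open>exp_rmax\<close> identifies \<open>rmax\<close> with the nonnegative reals under
  maximum and multiplication, so questions of order and of limits can be settled in the
  reals.\<close>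

definition less_eq_rmax :: "rmax \<Rightarrow> rmax \<Rightarrow> bool" where
  "less_eq_rmax a b \<longleftrightarrow> exp_rmax a \<le> exp_rmax b"

definition less_rmax :: "rmax \<Rightarrow> rmax \<Rightarrow> bool" where
  "less_rmax a b \<longleftrightarrow> exp_rmax a < exp_rmax b"

instance
  by standard (auto simp: less_eq_rmax_def less_rmax_def exp_rmax_inject)

end

lemma exp_rmax_nonneg [simp]: "0 \<le> exp_rmax a"
  by transfer simp

lemma exp_rmax_0 [simp]: "exp_rmax 0 = 0"
  by transfer simp

lemma exp_rmax_1 [simp]: "exp_rmax 1 = 1"
  by transfer simp

lemma exp_rmax_eq_0 [simp]: "exp_rmax a = 0 \<longleftrightarrow> a = 0"
  using exp_rmax_inject[of a 0] by simp

lemma exp_rmax_add: "exp_rmax (a + b) = max (exp_rmax a) (exp_rmax b)"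
proof transfer
  fix a b :: ereal
  assume "a \<noteq> \<infinity>" "b \<noteq> \<infinity>"
  then show "(if max a b = - \<infinity> then 0 else exp (real_of_ereal (max a b))) =
    max (if a = - \<infinity> then 0 else exp (real_of_ereal a))
      (if b = - \<infinity> then 0 else exp (real_of_ereal b))"
    by (cases a; cases b) (auto simp: max_def)
qed

lemma exp_rmax_mult: "exp_rmax (a * b) = exp_rmax a * exp_rmax b"
proof transfer
  fix a b :: ereal
  assume "a \<noteq> \<infinity>" "b \<noteq> \<infinity>"
  then show "(if a + b = - \<infinity> then 0 else exp (real_of_ereal (a + b))) =
    (if a = - \<infinity> then 0 else exp (real_of_ereal a)) *
    (if b = - \<infinity> then 0 else exp (real_of_ereal b))"
    by (cases a; cases b) (auto simp: exp_add)
qed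

lift_definition ln_rmax :: "real \<Rightarrow> rmax"
  is "\<lambda>r. if r \<le> 0 then - \<infinity> else ereal (ln r)"
  by simp

lemma exp_ln_rmax: "0 \<le> r \<Longrightarrow> exp_rmax (ln_rmax r) = r"
  by transfer auto

lemma add_rmax_eq_max: "a + b = max a (b :: rmax)"
  by (auto simp: max_def less_eq_rmax_def exp_rmax_add simp flip: exp_rmax_inject)

instance rmax :: canonically_ordered_monoid_add
proof
  show "a \<le> b \<longleftrightarrow> (\<exists>c. b = a + c)" for a b :: rmax
    unfolding add_rmax_eq_max by (metis max.absorb2 max.cobounded1)
qed

instance rmax :: ordered_comm_semiring
  by standard (simp add: less_eq_rmax_def exp_rmax_mult mult_left_mono)

lemma add_rmax_le_iff: "a + b \<le> c \<longleftrightarrow> a \<le> c \<and> b \<le> (c :: rmax)"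
  by (simp add: add_rmax_eq_max)

lemma add_rmax_absorb: "a + b = b \<longleftrightarrow> a \<le> (b :: rmax)"
  by (auto simp: add_rmax_eq_max max_def)

lemma sum_rmax_le_iff: "finite I \<Longrightarrow> sum f I \<le> c \<longleftrightarrow> (\<forall>i\<in>I. f i \<le> (c :: rmax))"
  by (induction I rule: finite_induct) (auto simp: add_rmax_le_iff)

text \<open>At zero the value is zero, because \<open>inverse 0 = 0\<close> in the reals; hence the
  nonzero argument in the residuation laws that follow.\<close>

definition inv_rmax :: "rmax \<Rightarrow> rmax" where
  "inv_rmax a = ln_rmax (inverse (exp_rmax a))"

lemma mult_inv_rmax: "a \<noteq> 0 \<Longrightarrow> a * inv_rmax a = 1"
  by (subst exp_rmax_inject[symmetric]) (simp add: inv_rmax_def exp_rmax_mult exp_ln_rmax)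

lemma mult_le_iff_le_inv_mult:
  assumes "a \<noteq> 0"
  shows "a * b \<le> c \<longleftrightarrow> b \<le> inv_rmax a * c"
proof -
  have "0 < exp_rmax a"
    using assms exp_rmax_nonneg[of a] by (simp add: less_le)
  then show ?thesis
    by (simp add: less_eq_rmax_def exp_rmax_mult inv_rmax_def exp_ln_rmax field_simps)
qed

lemma inv_mult_le_iff_le_mult:
  assumes "a \<noteq> 0"
  shows "inv_rmax a * b \<le> c \<longleftrightarrow> b \<le> a * c"
proof -
  have "0 < exp_rmax a"
    using assms exp_rmax_nonneg[of a] by (simp add: less_le)
  then show ?thesis
    by (simp add: less_eq_rmax_def exp_rmax_mult inv_rmax_def exp_ln_rmax field_simps)
qed

lemma tendsto_rmax_iff:
  "(f \<longlongrightarrow> a) F \<longleftrightarrow> ((\<lambda>x. exp_rmax (f x)) \<longlongrightarrow> exp_rmax a) F"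
  by (simp add: tendsto_iff dist_rmax_def dist_real_def)

instance rmax :: topological_comm_monoid_add
proof
  fix a b :: rmax
  have *: "((\<lambda>x. exp_rmax (fst x)) \<longlongrightarrow> exp_rmax a) (nhds a \<times>\<^sub>F nhds b)"
    "((\<lambda>x. exp_rmax (snd x)) \<longlongrightarrow> exp_rmax b) (nhds a \<times>\<^sub>F nhds b)"
    by (simp_all add: filterlim_fst filterlim_snd flip: tendsto_rmax_iff)
  show "LIM x nhds a \<times>\<^sub>F nhds b. fst x + snd x :> nhds (a + b)"
    unfolding tendsto_rmax_iff exp_rmax_add by (intro tendsto_max *)
qed

instance rmax :: topological_semigroup_mult
proof
  fix a b :: rmax
  have *: "((\<lambda>x. exp_rmax (fst x)) \<longlongrightarrow> exp_rmax a) (nhds a \<times>\<^sub>F nhds b)"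
    "((\<lambda>x. exp_rmax (snd x)) \<longlongrightarrow> exp_rmax b) (nhds a \<times>\<^sub>F nhds b)"
    by (simp_all add: filterlim_fst filterlim_snd flip: tendsto_rmax_iff)
  show "LIM x nhds a \<times>\<^sub>F nhds b. fst x * snd x :> nhds (a * b)"
    unfolding tendsto_rmax_iff exp_rmax_mult by (intro tendsto_mult *)
qed

text \<open>The distance of \<open>a\<close> to zero is \<open>exp_rmax a\<close>, and nothing lies
  below zero, so only an upper bound is at stake.\<close>

lemma bounded_rmax_iff: "bounded S \<longleftrightarrow> (\<exists>c. \<forall>a\<in>S. a \<le> (c :: rmax))"
proof -
  have "bounded S \<longleftrightarrow> (\<exists>e. \<forall>a\<in>S. exp_rmax a \<le> e)"
    by (simp add: bounded_any_center[of S 0] dist_rmax_def)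
  also have "\<dots> \<longleftrightarrow> (\<exists>c. \<forall>a\<in>S. a \<le> c)"
  proof
    assume "\<exists>e. \<forall>a\<in>S. exp_rmax a \<le> e"
    then obtain e where e: "\<And>a. a \<in> S \<Longrightarrow> exp_rmax a \<le> e"
      by blast
    have "a \<le> ln_rmax e" if "a \<in> S" for a
      using e[OF that] order_trans[OF exp_rmax_nonneg e[OF that]]
      by (simp add: less_eq_rmax_def exp_ln_rmax)
    then show "\<exists>c. \<forall>a\<in>S. a \<le> c"
      by blast
  qed (auto simp: less_eq_rmax_def)
  finally show ?thesis .
qed

instance rmax :: heine_borel
proof
  fix f :: "nat \<Rightarrow> rmax"
  assume "bounded (range f)"
  then have "bounded (range (\<lambda>n. exp_rmax (f n)))"
    by (auto simp: bounded_any_center[of _ 0] dist_rmax_def)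
  then obtain l r where r: "strict_mono r" and l: "((\<lambda>n. exp_rmax (f n)) \<circ> r) \<longlonglongrightarrow> l"
    using bounded_imp_convergent_subsequence by blast
  \<comment> \<open>The range of \<open>exp_rmax\<close> is the closed half-line, so the real limit
    \<open>l\<close> is the image of \<open>ln_rmax l\<close>.\<close>
  have "0 \<le> l"
    using LIMSEQ_le_const[OF l, of 0] by simp
  then have "(f \<circ> r) \<longlonglongrightarrow> ln_rmax l"
    using l by (simp add: tendsto_rmax_iff exp_ln_rmax comp_def)
  with r show "\<exists>l r. strict_mono r \<and> (f \<circ> r) \<longlonglongrightarrow> l"
    by blast
qed

lemma bounded_vec_rmax_iff:
  fixes S :: "(rmax ^ 'n) set"
  shows "bounded S \<longleftrightarrow> (\<forall>i. \<exists>c. \<forall>x\<in>S. x $ i \<le> c)"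
proof
  assume "bounded S"
  then show "\<forall>i. \<exists>c. \<forall>x\<in>S. x $ i \<le> c"
    using bounded_component_cart[of S] by (fastforce simp: bounded_rmax_iff)
next
  assume "\<forall>i. \<exists>c. \<forall>x\<in>S. x $ i \<le> c"
  then obtain c where c: "\<And>i x. x \<in> S \<Longrightarrow> x $ i \<le> c i"
    by metis
  have "dist 0 x \<le> (\<Sum>i\<in>UNIV. exp_rmax (c i))" if "x \<in> S" for x
  proof -
    have "dist 0 x \<le> (\<Sum>i\<in>UNIV. dist (0 $ i) (x $ i))"
      unfolding dist_vec_def by (rule L2_set_le_sum) simp
    also have "\<dots> \<le> (\<Sum>i\<in>UNIV. exp_rmax (c i))"
      using c[OF that] by (intro sum_mono) (simp add: dist_rmax_def less_eq_rmax_def)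
    finally show ?thesis .
  qed
  then show "bounded S"
    by (auto simp: bounded_def)
qed

subsection \<open>Continuity and closedness\<close>

lemma continuous_on_vecI:
  "(\<And>i. continuous_on S (\<lambda>x. f x $ i)) \<Longrightarrow> continuous_on S f"
  using continuous_on_vec_lambda[of S "\<lambda>i x. f x $ i"] by simp

lemma continuous_on_scalar_product [continuous_intros]:
  fixes f g :: "'a :: topological_space \<Rightarrow> rmax ^ 'n"
  shows "continuous_on S f \<Longrightarrow> continuous_on S g \<Longrightarrow>
    continuous_on S (\<lambda>x. scalar_product (f x) (g x))"
  unfolding scalar_product_def by (intro continuous_intros)

lemma closed_semimodule_orth: "closed (semimodule_orth X)"
proof -
  have "semimodule_orth X =
      (\<Inter>z\<in>X. {p. scalar_product (fst p) z = scalar_product (snd p) z})"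
    by (auto simp: semimodule_orth_def)
  then show ?thesis
    by (auto intro!: closed_INT closed_Collect_eq continuous_intros)
qed

lemma closed_congruence_orth: "closed (congruence_orth W)"
proof -
  have "congruence_orth W =
      (\<Inter>p\<in>W. {z. scalar_product (fst p) z = scalar_product (snd p) z})"
    by (force simp: congruence_orth_def)
  then show ?thesis
    by (auto intro!: closed_INT closed_Collect_eq continuous_intros)
qed

text \<open>A convergent sequence in the image is bounded, so by properness its preimages are
  bounded too; a subsequence of them converges to a preimage of the limit.\<close>

lemma closed_image_of_proper:
  fixes f :: "'a :: heine_borel \<Rightarrow> 'b :: metric_space"
  assumes S: "closed S" and f: "continuous_on S f"
    and proper: "\<And>B. bounded B \<Longrightarrow> bounded (S \<inter> f -` B)"
  shows "closed (f ` S)"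
  unfolding closed_sequential_limits
proof (intro allI impI, elim conjE)
  fix y l
  assume "\<forall>n. y n \<in> f ` S" and l: "y \<longlonglongrightarrow> l"
  then have "\<forall>n. \<exists>x. x \<in> S \<and> y n = f x"
    by auto
  then obtain x where x: "\<And>n. x n \<in> S" "\<And>n. y n = f (x n)"
    by metis
  have "range x \<subseteq> S \<inter> f -` range y"
    using x by auto
  then have "bounded (range x)"
    using proper convergent_imp_bounded[OF l] bounded_subset by blast
  then obtain a r where r: "strict_mono r" and a: "(x \<circ> r) \<longlonglongrightarrow> a"
    using bounded_imp_convergent_subsequence by blast
  have "a \<in> S"
    using closed_sequentially[OF S _ a] x by simp
  then have "(f \<circ> (x \<circ> r)) \<longlonglongrightarrow> f a"
    using f a x by (auto simp: continuous_on_sequentially)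
  moreover have "(f \<circ> (x \<circ> r)) \<longlonglongrightarrow> l"
    using LIMSEQ_subseq_LIMSEQ[OF l r] x by (simp add: comp_def)
  ultimately show "l \<in> f ` S"
    using \<open>a \<in> S\<close> LIMSEQ_unique by blast
qed

lemma closed_add_range:
  fixes D :: "rmax ^ 'm ^ 'n"
  assumes "closed X"
  shows "closed (X + range ((*v) D))"
proof -
  \<comment> \<open>A coordinate of \<open>u\<close> that \<open>D\<close> ignores is set to zero, which makes
    \<open>(x, u) \<mapsto> x + D *v u\<close> proper.\<close>
  define U where "U = {u :: rmax ^ 'm. \<forall>j. (\<forall>i. D $ i $ j = 0) \<longrightarrow> u $ j = 0}"
  define f where "f = (\<lambda>(x, u). x + D *v u)"
  have "\<exists>u'\<in>U. D *v u = D *v u'" for u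
  proof
    let ?u = "\<chi> j. if \<forall>i. D $ i $ j = 0 then 0 else u $ j"
    show "?u \<in> U"
      by (simp add: U_def)
    show "D *v u = D *v ?u"
      by (auto simp: vec_eq_iff matrix_vector_mult_def intro!: sum.cong)
  qed
  then have "range ((*v) D) \<subseteq> (*v) D ` U"
    by blast
  then have "X + range ((*v) D) = X + (*v) D ` U"
    by (intro arg_cong2[of _ _ _ _ "(+)"]) auto
  also have "\<dots> = f ` (X \<times> U)"
    unfolding f_def set_plus_def by auto
  finally have "X + range ((*v) D) = f ` (X \<times> U)" .
  moreover have "closed (f ` (X \<times> U))"
  proof (rule closed_image_of_proper)
    have "U = (\<Inter>j\<in>{j. \<forall>i. D $ i $ j = 0}. {u. u $ j = 0})"
      by (auto simp: U_def)
    also have "closed \<dots>"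
      by (intro closed_INT ballI closed_Collect_eq continuous_intros)
    finally show "closed (X \<times> U)"
      using assms by (rule closed_Times[rotated])
    show "continuous_on (X \<times> U) f"
      unfolding f_def case_prod_beta
      by (intro continuous_on_vecI) (simp add: matrix_vector_mult_def, intro continuous_intros)
    fix B :: "(rmax ^ 'n) set"
    assume "bounded B"
    then obtain c where *: "\<And>i z. z \<in> B \<Longrightarrow> z $ i \<le> c i"
      unfolding bounded_vec_rmax_iff by metis
    \<comment> \<open>Max-plus addition has no cancellation: each summand lies below the sum, so a
      bound on the sum bounds both.\<close>
    then have c: "x $ i \<le> c i" "(D *v u) $ i \<le> c i"
      if "(x, u) \<in> X \<times> U \<inter> f -` B" for i x u
    proof -
      from that have "x + D *v u \<in> B"
        by (simp add: f_def)
      then have "(x + D *v u) $ i \<le> c i"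
        by (rule *)
      then show "x $ i \<le> c i" "(D *v u) $ i \<le> c i"
        by (simp_all add: add_rmax_le_iff)
    qed
    have "\<exists>c. \<forall>u \<in> snd ` (X \<times> U \<inter> f -` B). u $ j \<le> c" for j
    proof (cases "\<forall>i. D $ i $ j = 0")
      case True
      then show ?thesis
        by (auto simp: U_def)
    next
      case False
      then obtain i where i: "D $ i $ j \<noteq> 0"
        by blast
      \<comment> \<open>A nonzero entry in column \<open>j\<close> turns the bound on
        \<open>D *v u\<close> into one on \<open>u $ j\<close> by division.\<close>
      have "u $ j \<le> inv_rmax (D $ i $ j) * c i" if "u \<in> snd ` (X \<times> U \<inter> f -` B)" for u
      proof -
        have "D $ i $ j * u $ j \<le> (D *v u) $ i"
          unfolding matrix_vector_mult_def
          by (simp add: member_le_sum[of j UNIV "\<lambda>j. D $ i $ j * u $ j"])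
        also have "\<dots> \<le> c i"
          using that c(2) by auto
        finally show ?thesis
          using i by (simp add: mult_le_iff_le_inv_mult)
      qed
      then show ?thesis
        by blast
    qed
    then have "bounded (snd ` (X \<times> U \<inter> f -` B))"
      unfolding bounded_vec_rmax_iff by (rule allI)
    moreover have "bounded (fst ` (X \<times> U \<inter> f -` B))"
      unfolding bounded_vec_rmax_iff
    proof
      show "\<exists>b. \<forall>x \<in> fst ` (X \<times> U \<inter> f -` B). x $ i \<le> b" for i
        using c(1) by (intro exI[of _ "c i"]) auto
    qed
    ultimately have "bounded (fst ` (X \<times> U \<inter> f -` B) \<times> snd ` (X \<times> U \<inter> f -` B))"
      by (intro bounded_Times)
    then show "bounded (X \<times> U \<inter> f -` B)"
      by (rule bounded_subset) (rule subset_fst_snd)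
  qed
  ultimately show ?thesis
    by simp
qed

subsection \<open>Duality of closed semimodules and closed congruences\<close>

lemma scalar_product_commute:
  fixes x y :: "rmax ^ 'n"
  shows "scalar_product x y = scalar_product y x"
  by (simp add: scalar_product_def mult.commute)

lemma scalar_product_lincomb_left:
  fixes x y z :: "rmax ^ 'n"
  shows "scalar_product (a *s x + b *s y) z = a * scalar_product x z + b * scalar_product y z"
  using scalar_product_lincomb[of z a x b y] by (simp add: scalar_product_commute)

lemma scalar_product_add_right:
  fixes x y z :: "rmax ^ 'n"
  shows "scalar_product x (y + z) = scalar_product x y + scalar_product x z"
  using scalar_product_lincomb[of x 1 y 1 z] by simp

lemma scalar_product_add_left:
  fixes x y z :: "rmax ^ 'n"
  shows "scalar_product (x + y) z = scalar_product x z + scalar_product y z"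
  using scalar_product_lincomb_left[of 1 x 1 y z] by simp

lemma scalar_product_smult_left:
  fixes x z :: "rmax ^ 'n"
  shows "scalar_product (a *s x) z = a * scalar_product x z"
  using scalar_product_lincomb_left[of a x 0 x z] by simp

lemma scalar_product_transpose:
  fixes E :: "rmax ^ 'n ^ 'm"
  shows "scalar_product x (transpose E *v z) = scalar_product (E *v x) z"
  unfolding scalar_product_def matrix_vector_mult_def transpose_def
  by (simp add: sum_distrib_left sum_distrib_right mult_ac) (rule sum.swap)

lemma scalar_product_axis:
  fixes x :: "rmax ^ 'n"
  shows "scalar_product x (axis i 1) = x $ i" "scalar_product (axis i 1) x = x $ i"
  by (simp_all add: scalar_product_def axis_def if_distrib if_distribR cong: if_cong)

lemma scalar_product_le_iff:
  fixes x y :: "rmax ^ 'n"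
  shows "scalar_product x y \<le> c \<longleftrightarrow> (\<forall>i. x $ i * y $ i \<le> c)"
  by (simp add: scalar_product_def sum_rmax_le_iff)

lemma subsemimodule_vec_iff:
  fixes X :: "(rmax ^ 'n) set"
  shows "subsemimodule (*s) X \<longleftrightarrow>
    0 \<in> X \<and> (\<forall>x\<in>X. \<forall>y\<in>X. x + y \<in> X) \<and> (\<forall>a. \<forall>x\<in>X. a *s x \<in> X)"
proof
  assume X: "subsemimodule (*s) X"
  then have lc: "a *s x + b *s y \<in> X" if "x \<in> X" "y \<in> X" for a b x y
    using that by (auto simp: subsemimodule_def)
  obtain x where "x \<in> X"
    using X by (auto simp: subsemimodule_def)
  then have "0 \<in> X"
    using lc[of x x 0 0] by simp
  moreover have "a *s x \<in> X" if "x \<in> X" for a x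
    using lc[OF that that, of a 0] by simp
  moreover have "x + y \<in> X" if "x \<in> X" "y \<in> X" for x y
    using lc[OF that, of 1 1] by simp
  ultimately show "0 \<in> X \<and> (\<forall>x\<in>X. \<forall>y\<in>X. x + y \<in> X) \<and> (\<forall>a. \<forall>x\<in>X. a *s x \<in> X)"
    by blast
next
  assume "0 \<in> X \<and> (\<forall>x\<in>X. \<forall>y\<in>X. x + y \<in> X) \<and> (\<forall>a. \<forall>x\<in>X. a *s x \<in> X)"
  then show "subsemimodule (*s) X"
    unfolding subsemimodule_def by blast
qed

lemma subsemimodule_sum:
  fixes X :: "(rmax ^ 'n) set"
  assumes "subsemimodule (*s) X" "\<And>i. i \<in> I \<Longrightarrow> f i \<in> X"
  shows "sum f I \<in> X"
  using assms by (induction I rule: infinite_finite_induct) (auto simp: subsemimodule_vec_iff)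

section \<open>Separation of a point from a closed semimodule\<close>

lemma tendsto_rmax_sandwich:
  fixes f g h :: "nat \<Rightarrow> rmax"
  assumes "f \<longlonglongrightarrow> a" "h \<longlonglongrightarrow> a" "\<And>n. f n \<le> g n" "\<And>n. g n \<le> h n"
  shows "g \<longlonglongrightarrow> a"
  unfolding tendsto_rmax_iff
proof (rule tendsto_sandwich)
  show "(\<lambda>n. exp_rmax (f n)) \<longlonglongrightarrow> exp_rmax a" "(\<lambda>n. exp_rmax (h n)) \<longlonglongrightarrow> exp_rmax a"
    using assms by (simp_all add: tendsto_rmax_iff)
qed (use assms in \<open>simp_all add: less_eq_rmax_def\<close>)

text \<open>On the scale of \<open>exp_rmax\<close>, every coordinate is raised to at least 1/(n+1):
  all coordinates become invertible, and the change vanishes in the limit.\<close>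

definition perturb :: "nat \<Rightarrow> rmax ^ 'n \<Rightarrow> rmax ^ 'n" where
  "perturb n x = x + (\<chi> i. ln_rmax (inverse (Suc n)))"

lemma perturb_ge: "x \<le> perturb n x"
  by (simp add: perturb_def less_eq_vec_def add_rmax_eq_max)

lemma perturb_nonzero: "perturb n x $ i \<noteq> 0"
proof -
  have "0 < exp_rmax (perturb n x $ i)"
    by (simp add: perturb_def exp_rmax_add exp_ln_rmax less_max_iff_disj)
  then show ?thesis
    by fastforce
qed

lemma tendsto_perturb: "(\<lambda>n. perturb n x) \<longlonglongrightarrow> x"
proof (rule vec_tendstoI)
  fix i
  have "(\<lambda>n. ln_rmax (inverse (Suc n))) \<longlonglongrightarrow> 0"
    using LIMSEQ_inverse_real_of_nat by (simp add: tendsto_rmax_iff exp_ln_rmax)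
  then have "(\<lambda>n. x $ i + ln_rmax (inverse (Suc n))) \<longlonglongrightarrow> x $ i + 0"
    by (intro tendsto_intros)
  then show "(\<lambda>n. perturb n x $ i) \<longlonglongrightarrow> x $ i"
    by (simp add: perturb_def)
qed

lemma semimodule_separation:
  fixes X :: "(rmax ^ 'n) set"
  assumes X: "subsemimodule (*s) X" and "closed X" and "s \<notin> X"
  obtains x y where "(x, y) \<in> semimodule_orth X" "scalar_product x s \<noteq> scalar_product y s"
proof -
  \<comment> \<open>These scalars lie strictly below 1 and tend to 1; the gap is what later makes
    \<open>p < s $ i\<close> strict.\<close>
  define c where "c n = ln_rmax (1 - inverse (Suc n))" for n
  have exp_c: "exp_rmax (c n) = 1 - inverse (Suc n)" for n
    by (simp add: c_def exp_ln_rmax inverse_le_1_iff)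
  have c_lim: "c \<longlonglongrightarrow> 1"
    using tendsto_diff[OF tendsto_const[of 1] LIMSEQ_inverse_real_of_nat]
    by (simp add: tendsto_rmax_iff exp_c)
  \<comment> \<open>Some coordinate of \<open>s\<close> cannot be nearly reached from inside
    \<open>X\<close> below the perturbation. Otherwise the sum of the approximants over all
    coordinates stays in \<open>X\<close> and is squeezed between \<open>c n *s s\<close> and
    \<open>perturb n s\<close>, so \<open>s\<close> would lie in the closed set
    \<open>X\<close>.\<close>
  have "\<exists>n i. \<forall>z\<in>X. z \<le> perturb n s \<longrightarrow> \<not> c n * s $ i \<le> z $ i"
  proof (rule ccontr)
    assume "\<not> ?thesis"
    then obtain z where z: "\<And>n i. z n i \<in> X" "\<And>n i. z n i \<le> perturb n s"
        "\<And>n i. c n * s $ i \<le> z n i $ i"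
      by metis
    define w where "w n = (\<Sum>i\<in>UNIV. z n i)" for n
    have "w n \<in> X" for n
      unfolding w_def using X z by (intro subsemimodule_sum)
    moreover have "w \<longlonglongrightarrow> s"
    proof (rule vec_tendstoI)
      fix i
      show "(\<lambda>n. w n $ i) \<longlonglongrightarrow> s $ i"
      proof (rule tendsto_rmax_sandwich[where f = "\<lambda>n. c n * s $ i" and
            h = "\<lambda>n. perturb n s $ i"])
        show "(\<lambda>n. perturb n s $ i) \<longlonglongrightarrow> s $ i"
          by (intro tendsto_intros tendsto_perturb)
        show "(\<lambda>n. c n * s $ i) \<longlonglongrightarrow> s $ i"
          using tendsto_mult[OF c_lim tendsto_const[of "s $ i"]] by simp
        show "w n $ i \<le> perturb n s $ i" for n
          using z(2) by (simp add: w_def sum_rmax_le_iff less_eq_vec_def)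
        have "z n i $ i \<le> w n $ i" for n
          by (simp add: w_def member_le_sum[of i UNIV "\<lambda>j. z n j $ i"])
        then show "c n * s $ i \<le> w n $ i" for n
          using z(3) order_trans by blast
      qed
    qed
    ultimately have "s \<in> X"
      using \<open>closed X\<close> closed_sequentially by blast
    with \<open>s \<notin> X\<close> show False ..
  qed
  then obtain n i where ni: "\<And>z. z \<in> X \<Longrightarrow> z \<le> perturb n s \<Longrightarrow> \<not> c n * s $ i \<le> z $ i"
    by blast
  define p where "p = c n * s $ i"
  \<comment> \<open>With these inverses, \<open>scalar_product v z\<close> is the least
    \<open>l\<close> with \<open>z\<close> below \<open>l *s perturb n s\<close>.\<close>
  define v where "v = (\<chi> j. inv_rmax (perturb n s $ j))"
  have "s $ i \<noteq> 0"
    using ni[of 0] X by (auto simp: subsemimodule_vec_iff less_eq_vec_def)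
  then have "0 < exp_rmax (s $ i)"
    using exp_rmax_nonneg[of "s $ i"] by (simp add: less_le)
  then have p_less: "p < s $ i"
    by (simp add: p_def less_rmax_def exp_rmax_mult exp_c)
  have le: "z $ i \<le> p * scalar_product v z" if "z \<in> X" for z
  proof (cases "scalar_product v z = 0")
    case True
    then have "v $ i * z $ i \<le> 0"
      using scalar_product_le_iff[of v z 0] by (metis order_refl)
    then have "z $ i \<le> perturb n s $ i * 0"
      unfolding v_def vec_lambda_beta inv_mult_le_iff_le_mult[OF perturb_nonzero] .
    then show ?thesis
      by simp
  next
    case False
    let ?l = "scalar_product v z"
    \<comment> \<open>Dividing \<open>z\<close> by this \<open>l\<close> gives an element of
      \<open>X\<close> below the perturbation, to which the choice of \<open>n\<close> and
      \<open>i\<close> applies.\<close>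
    have "inv_rmax ?l * z $ j \<le> perturb n s $ j" for j
    proof -
      have "v $ j * z $ j \<le> ?l"
        using scalar_product_le_iff[of v z ?l] by auto
      then have "z $ j \<le> perturb n s $ j * ?l"
        unfolding v_def vec_lambda_beta inv_mult_le_iff_le_mult[OF perturb_nonzero] .
      then show ?thesis
        unfolding inv_mult_le_iff_le_mult[OF False] by (simp add: mult.commute)
    qed
    then have "inv_rmax ?l *s z \<le> perturb n s"
      by (simp add: less_eq_vec_def)
    then have "\<not> p \<le> inv_rmax ?l * z $ i"
      using ni[of "inv_rmax ?l *s z"] X \<open>z \<in> X\<close> by (simp add: p_def subsemimodule_vec_iff)
    then have "inv_rmax ?l * z $ i \<le> p"
      by simp
    then show ?thesis
      unfolding inv_mult_le_iff_le_mult[OF False] by (simp add: mult.commute)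
  qed
  \<comment> \<open>An inequality between functionals becomes a pair: \<open>f + g = g\<close> says
    exactly that \<open>f\<close> is below \<open>g\<close>.\<close>
  have "(axis i 1 + p *s v, p *s v) \<in> semimodule_orth X"
    using le by (simp add: semimodule_orth_def scalar_product_add_left scalar_product_axis
        scalar_product_smult_left add_rmax_absorb)
  \<comment> \<open>The point \<open>s\<close> violates the inequality: its right side is at most
    \<open>p\<close>, whereas its left side is \<open>s $ i\<close>.\<close>
  moreover have "p * scalar_product v s \<le> p"
  proof -
    have "scalar_product v s \<le> 1"
      using perturb_ge[of s n]
      by (simp add: scalar_product_le_iff v_def inv_mult_le_iff_le_mult perturb_nonzero
          less_eq_vec_def)
    from mult_left_mono[OF this, of p] show ?thesis
      by simp
  qed
  ultimately show ?thesis
    using that p_less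
    by (fastforce simp: scalar_product_add_left scalar_product_axis scalar_product_smult_left
        add_rmax_absorb)
qed

section \<open>Separation of a pair from a closed congruence\<close>

lemma congruence_lemmas:
  assumes "congruence W"
  shows congruence_refl: "(x, x) \<in> W"
    and congruence_sym: "(x, y) \<in> W \<Longrightarrow> (y, x) \<in> W"
    and congruence_trans: "(x, y) \<in> W \<Longrightarrow> (y, z) \<in> W \<Longrightarrow> (x, z) \<in> W"
    and congruence_add: "(x, y) \<in> W \<Longrightarrow> (x', y') \<in> W \<Longrightarrow> (x + x', y + y') \<in> W"
    and congruence_smult: "(x, y) \<in> W \<Longrightarrow> (a *s x, a *s y) \<in> W"
proof -
  have eq: "equiv UNIV W" and "subsemimodule smult_pair W"
    using assms by (auto simp: congruence_def)
  then have lc: "(a *s x + b *s x', a *s y + b *s y') \<in> W"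
    if "(x, y) \<in> W" "(x', y') \<in> W" for a b x x' y y'
    using that by (fastforce simp: subsemimodule_def smult_pair_def)
  show "(x, x) \<in> W"
    using eq by (auto simp: equiv_def refl_on_def)
  show "(x, y) \<in> W \<Longrightarrow> (y, x) \<in> W"
    using eq by (auto simp: equiv_def dest: symD)
  show "(x, y) \<in> W \<Longrightarrow> (y, z) \<in> W \<Longrightarrow> (x, z) \<in> W"
    using eq by (auto simp: equiv_def dest: transD)
  show "(x, y) \<in> W \<Longrightarrow> (x', y') \<in> W \<Longrightarrow> (x + x', y + y') \<in> W"
    using lc[of x y x' y' 1 1] by simp
  show "(x, y) \<in> W \<Longrightarrow> (a *s x, a *s y) \<in> W"
    using lc[of x y x y a 0] by simp
qed

lemma add_vec_rmax_idem:
  fixes x :: "rmax ^ 'n"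
  shows "x + x = x" "x + (x + y) = x + y"
  by (simp_all add: vec_eq_iff add_rmax_eq_max)

text \<open>For a congruence \<open>W\<close> this is the natural order of the quotient semimodule,
  whose addition is idempotent, pulled back to representatives.\<close>

definition below_mod :: "((rmax ^ 'n) \<times> (rmax ^ 'n)) set \<Rightarrow> rmax ^ 'n \<Rightarrow> rmax ^ 'n \<Rightarrow> bool" where
  "below_mod W x y \<longleftrightarrow> (x + y, y) \<in> W"

lemma below_mod_lemmas:
  assumes W: "congruence W"
  shows below_mod_of_le: "x \<le> y \<Longrightarrow> below_mod W x y"
    and below_mod_of_mem: "(x, y) \<in> W \<Longrightarrow> below_mod W x y"
    and below_mod_trans: "below_mod W x y \<Longrightarrow> below_mod W y z \<Longrightarrow> below_mod W x z"
    and below_mod_add: "below_mod W x z \<Longrightarrow> below_mod W y z \<Longrightarrow> below_mod W (x + y) z"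
    and below_mod_smult: "below_mod W x y \<Longrightarrow> below_mod W (a *s x) (a *s y)"
    and below_mod_antisym: "below_mod W x y \<Longrightarrow> below_mod W y x \<Longrightarrow> (x, y) \<in> W"
proof -
  note refl = congruence_refl[OF W] and sym = congruence_sym[OF W]
    and trans = congruence_trans[OF W] and add = congruence_add[OF W]
  show "below_mod W x y" if "x \<le> y"
  proof -
    have "x + y = y"
      using that by (simp add: vec_eq_iff less_eq_vec_def add_rmax_absorb)
    then show ?thesis
      by (simp add: below_mod_def refl)
  qed
  show "below_mod W x y" if "(x, y) \<in> W"
    using add[OF that refl[of y]] by (simp add: below_mod_def add_vec_rmax_idem)
  show "below_mod W x z" if xy: "below_mod W x y" and yz: "below_mod W y z"
  proof -
    have "(x + z, x + (y + z)) \<in> W"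
      using add[OF refl sym] yz by (simp add: below_mod_def)
    moreover have "(x + (y + z), y + z) \<in> W"
      using add[OF _ refl[of z]] xy by (fastforce simp: below_mod_def add.assoc)
    ultimately show ?thesis
      using yz trans unfolding below_mod_def by blast
  qed
  show "below_mod W (x + y) z" if "below_mod W x z" "below_mod W y z"
  proof -
    have "((x + z) + (y + z), z + z) \<in> W"
      using that add by (simp add: below_mod_def)
    then show ?thesis
      by (simp add: below_mod_def add_vec_rmax_idem ac_simps)
  qed
  show "below_mod W (a *s x) (a *s y)" if "below_mod W x y"
    using congruence_smult[OF W that[unfolded below_mod_def], of a]
    by (simp add: below_mod_def vector_add_ldistrib)
  show "(x, y) \<in> W" if "below_mod W x y" "below_mod W y x"
    using that sym trans unfolding below_mod_def by (metis add.commute)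
qed

lemma vec_rmax_expansion:
  fixes x :: "rmax ^ 'n"
  shows "(\<Sum>i\<in>UNIV. x $ i *s axis i 1) = x"
  by (simp add: vec_eq_iff axis_def if_distrib cong: if_cong)

text \<open>The distance to zero is \<open>exp_rmax\<close>, so a point of \<open>L\<close> nearest
  to zero is its least element.\<close>

lemma closed_rmax_has_least:
  fixes L :: "rmax set"
  assumes "closed L" "L \<noteq> {}"
  obtains m where "m \<in> L" "\<And>l. l \<in> L \<Longrightarrow> m \<le> l"
  using distance_attains_inf[OF assms, of 0] that
  by (auto simp: dist_rmax_def less_eq_rmax_def)

text \<open>The separating functional is \<open>x \<mapsto> min {l. below_mod W x (l *s t')}\<close>; it is finite
  because no coordinate of the perturbation \<open>t'\<close> of \<open>t\<close> is zero.\<close>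

lemma congruence_separation_below:
  assumes W: "congruence W" and "closed W" and st: "\<not> below_mod W s t"
  obtains z where "z \<in> congruence_orth W" "scalar_product s z \<noteq> scalar_product t z"
proof -
  note trans = below_mod_trans[OF W] and le = below_mod_of_le[OF W]
    and smult = below_mod_smult[OF W]
  \<comment> \<open>If \<open>s\<close> were below every perturbation of \<open>t\<close> modulo
    \<open>W\<close>, closedness of \<open>W\<close> would carry this to the limit
    \<open>t\<close>.\<close>
  have "\<exists>n. \<not> below_mod W s (perturb n t)"
  proof (rule ccontr)
    assume "\<not> ?thesis"
    then have "\<And>n. (s + perturb n t, perturb n t) \<in> W"
      by (simp add: below_mod_def)
    moreover have "(\<lambda>n. s + perturb n t) \<longlonglongrightarrow> s + t"
      unfolding plus_vec_def by (intro tendsto_vec_lambda tendsto_intros tendsto_perturb)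
    then have "(\<lambda>n. (s + perturb n t, perturb n t)) \<longlonglongrightarrow> (s + t, t)"
      by (intro tendsto_Pair tendsto_perturb)
    ultimately have "(s + t, t) \<in> W"
      by (rule closed_sequentially[OF \<open>closed W\<close>])
    with st show False
      by (simp add: below_mod_def)
  qed
  then obtain n where n: "\<not> below_mod W s (perturb n t)" ..
  define t' where "t' = perturb n t"
  \<comment> \<open>These are the values of the separating functional on the unit vectors. The
    admissible scalars form a closed set, as a continuous preimage of \<open>W\<close>, and a
    nonempty one, as \<open>t'\<close> has invertible coordinates.\<close>
  have "\<exists>m. below_mod W (axis i 1) (m *s t') \<and>
      (\<forall>l. below_mod W (axis i 1) (l *s t') \<longrightarrow> m \<le> l)" for i
  proof -
    let ?L = "{l. below_mod W (axis i 1) (l *s t')}"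
    let ?g = "\<lambda>l. (axis i 1 + l *s t', l *s t')"
    have "continuous_on UNIV ?g"
      by (intro continuous_on_Pair continuous_on_vecI; simp; intro continuous_intros)
    then have "closed (?g -` W)"
      by (rule closed_vimage[OF \<open>closed W\<close>])
    then have "closed ?L"
      by (simp add: below_mod_def vimage_def)
    moreover have "axis i 1 \<le> inv_rmax (t' $ i) *s t'"
      using mult_inv_rmax[of "t' $ i"]
      by (simp add: less_eq_vec_def axis_def t'_def perturb_nonzero mult.commute)
    then have "?L \<noteq> {}"
      using le by blast
    ultimately show ?thesis
      by (elim closed_rmax_has_least) auto
  qed
  then obtain m where m: "\<And>i. below_mod W (axis i 1) (m i *s t')"
      and m_least: "\<And>i l. below_mod W (axis i 1) (l *s t') \<Longrightarrow> m i \<le> l"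
    by metis
  define z where "z = (\<chi> i. m i)"
  \<comment> \<open>The vector \<open>z\<close> represents the functional on all of the space. One
    direction expands \<open>x\<close> in unit vectors; the other divides \<open>x\<close> by a
    nonzero coordinate and uses minimality of \<open>m i\<close>.\<close>
  have z_le_iff: "scalar_product x z \<le> l \<longleftrightarrow> below_mod W x (l *s t')" for x l
  proof
    assume "scalar_product x z \<le> l"
    then have xl: "x $ i * m i \<le> l" for i
      by (simp add: scalar_product_le_iff z_def)
    have summand: "below_mod W (x $ i *s axis i 1) (l *s t')" for i
    proof (rule trans)
      show "below_mod W (x $ i *s axis i 1) (x $ i *s (m i *s t'))"
        by (intro smult m)
      show "below_mod W (x $ i *s (m i *s t')) (l *s t')"
        using xl by (intro le) (simp add: less_eq_vec_def mult_right_mono flip: mult.assoc)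
    qed
    have "below_mod W (\<Sum>i\<in>I. x $ i *s axis i 1) (l *s t')" if "finite I" for I
      using that
      by (induction I rule: finite_induct)
        (auto intro: le summand below_mod_add[OF W] simp: less_eq_vec_def)
    from this[OF finite, of UNIV] show "below_mod W x (l *s t')"
      by (simp only: vec_rmax_expansion)
  next
    assume x: "below_mod W x (l *s t')"
    have "x $ i * m i \<le> l" for i
    proof (cases "x $ i = 0")
      case False
      have "below_mod W (axis i 1) (inv_rmax (x $ i) *s x)"
        using mult_inv_rmax[OF False]
        by (intro le) (simp add: less_eq_vec_def axis_def mult.commute)
      then have "below_mod W (axis i 1) (inv_rmax (x $ i) *s (l *s t'))"
        using trans smult[OF x] by blast
      then have "m i \<le> inv_rmax (x $ i) * l"
        by (intro m_least) simp
      then show ?thesis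
        using False by (simp add: mult_le_iff_le_inv_mult)
    qed simp
    then show "scalar_product x z \<le> l"
      by (simp add: scalar_product_le_iff z_def)
  qed
  \<comment> \<open>Points related by \<open>W\<close> are below the same multiples of
    \<open>t'\<close>, so the functional does not tell them apart.\<close>
  have "scalar_product x z = scalar_product y z" if "(x, y) \<in> W" for x y
  proof (rule antisym)
    show "scalar_product x z \<le> scalar_product y z"
      using trans[OF below_mod_of_mem[OF W that]] z_le_iff by blast
    show "scalar_product y z \<le> scalar_product x z"
      using trans[OF below_mod_of_mem[OF W congruence_sym[OF W that]]] z_le_iff by blast
  qed
  then have "z \<in> congruence_orth W"
    by (auto simp: congruence_orth_def)
  \<comment> \<open>The threshold 1 corresponds to \<open>t'\<close> itself, which dominates
    \<open>t\<close> but not \<open>s\<close> modulo \<open>W\<close>.\<close>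
  moreover have "scalar_product t z \<le> 1" "\<not> scalar_product s z \<le> 1"
    using n le[OF perturb_ge] by (auto simp: z_le_iff t'_def)
  ultimately show ?thesis
    using that by metis
qed

lemma semimodule_orth_congruence_orth:
  assumes W: "congruence W" and "closed W"
  shows "semimodule_orth (congruence_orth W) = W"
proof
  show "W \<subseteq> semimodule_orth (congruence_orth W)"
    by (auto simp: semimodule_orth_def congruence_orth_def)
  show "semimodule_orth (congruence_orth W) \<subseteq> W"
  proof clarify
    fix s t
    assume st: "(s, t) \<in> semimodule_orth (congruence_orth W)"
    have "below_mod W s t"
      by (rule ccontr, erule congruence_separation_below[OF assms])
        (use st in \<open>auto simp: semimodule_orth_def\<close>)
    moreover have "below_mod W t s"
      by (rule ccontr, erule congruence_separation_below[OF assms])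
        (use st in \<open>auto simp: semimodule_orth_def\<close>)
    ultimately show "(s, t) \<in> W"
      by (rule below_mod_antisym[OF W])
  qed
qed

subsection \<open>Controlled and conditioned invariance\<close>

lemma congruence_semimodule_orth: "congruence (semimodule_orth X)"
proof -
  have "equiv UNIV (semimodule_orth X)"
    by (auto simp: semimodule_orth_def equiv_def refl_on_def sym_def trans_def)
  moreover have "subsemimodule smult_pair (semimodule_orth X)"
    unfolding subsemimodule_def
    by (auto simp: semimodule_orth_def smult_pair_def scalar_product_lincomb_left)
  ultimately show ?thesis
    by (simp add: congruence_def)
qed

text \<open>Transposition moves \<open>A\<close> onto \<open>z\<close>, and
  \<open>transpose A *v z\<close> splits as \<open>w + transpose C *v u\<close>. A pair orthogonal
  to \<open>X\<close> agrees on \<open>w\<close>, and a pair in the kernel of \<open>C\<close>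
  agrees on the other term.\<close>

lemma conditioned_invariant_semimodule_orth:
  assumes "controlled_invariant (transpose A) (transpose C) X"
  shows "conditioned_invariant C A (semimodule_orth X)"
  unfolding conditioned_invariant_def
proof (intro conjI congruence_semimodule_orth subsetI)
  fix p
  assume "p \<in> map_prod ((*v) A) ((*v) A) ` (semimodule_orth X \<inter> mat_ker C)"
  then obtain x y where p: "p = (A *v x, A *v y)"
      and xy: "(x, y) \<in> semimodule_orth X" and C: "C *v x = C *v y"
    by (auto simp: mat_ker_def)
  have "scalar_product (A *v x) z = scalar_product (A *v y) z" if "z \<in> X" for z
  proof -
    have "transpose A *v z \<in> X + range ((*v) (transpose C))"
      using assms that by (auto simp: controlled_invariant_def)
    then obtain w u where w: "w \<in> X" and eq: "transpose A *v z = w + transpose C *v u"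
      by (auto elim!: set_plus_elim)
    have "scalar_product (A *v v) z = scalar_product v w + scalar_product (C *v v) u" for v
      by (simp only: eq scalar_product_add_right flip: scalar_product_transpose)
    then show ?thesis
      using xy w C by (auto simp: semimodule_orth_def)
  qed
  then show "p \<in> semimodule_orth X"
    by (simp add: p semimodule_orth_def)
qed

lemma controlled_invariant_congruence_orth:
  fixes C :: "rmax ^ 'n ^ 'q"
  assumes W: "conditioned_invariant C A W" and "closed W"
  shows "controlled_invariant (transpose A) (transpose C) (congruence_orth W)"
  unfolding controlled_invariant_def
proof (intro conjI subsemimodule_congruence_orth subsetI)
  let ?K = "congruence_orth W"
  let ?X = "?K + range ((*v) (transpose C))"
  have congr: "congruence W"
    using W by (simp add: conditioned_invariant_def)
  have K: "subsemimodule (*s) ?K"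
    by (rule subsemimodule_congruence_orth)
  fix a
  assume "a \<in> (*v) (transpose A) ` ?K"
  then obtain z where z: "z \<in> ?K" and a: "a = transpose A *v z"
    by blast
  have X: "subsemimodule (*s) ?X"
    unfolding subsemimodule_def
  proof (intro conjI allI ballI)
    show "?X \<noteq> {}"
      using z by (auto simp: set_plus_def)
    fix b c x y
    assume "x \<in> ?X" "y \<in> ?X"
    then obtain v w s t where "v \<in> ?K" "w \<in> ?K"
        and x: "x = v + transpose C *v s" and y: "y = w + transpose C *v t"
      by (auto elim!: set_plus_elim)
    then have "b *s v + c *s w \<in> ?K"
      using K by (simp add: subsemimodule_def)
    moreover have "b *s x + c *s y =
        (b *s v + c *s w) + transpose C *v (b *s s + c *s t)"
      by (simp add: x y matrix_vector_mult_lincomb vector_add_ldistrib ac_simps)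
    ultimately show "b *s x + c *s y \<in> ?X"
      by (auto intro: set_plus_intro)
  qed
  show "a \<in> ?X"
  proof (rule ccontr)
    assume "a \<notin> ?X"
    then obtain x y where xy: "(x, y) \<in> semimodule_orth ?X"
        and neq: "scalar_product x a \<noteq> scalar_product y a"
      using semimodule_separation[OF X closed_add_range[OF closed_congruence_orth]] by blast
    have orth: "scalar_product x (v + transpose C *v u) = scalar_product y (v + transpose C *v u)"
      if "v \<in> ?K" for v u
      using xy that by (auto simp: semimodule_orth_def intro: set_plus_intro)
    have "(x, y) \<in> semimodule_orth ?K"
      using orth[of _ 0] by (auto simp: semimodule_orth_def)
    then have "(x, y) \<in> W"
      using semimodule_orth_congruence_orth[OF congr \<open>closed W\<close>] by simp
    \<comment> \<open>Testing with \<open>v = 0\<close> and \<open>u\<close> a unit vector reads off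
      one coordinate of \<open>C *v x\<close>.\<close>
    moreover have "(C *v x) $ j = (C *v y) $ j" for j
      using orth[of 0 "axis j 1"] K
      by (simp add: subsemimodule_vec_iff scalar_product_transpose scalar_product_axis
          del: transpose_matrix_vector)
    then have "(x, y) \<in> mat_ker C"
      by (simp add: mat_ker_def vec_eq_iff)
    ultimately have "(A *v x, A *v y) \<in> W"
      using W by (auto simp: conditioned_invariant_def)
    then have "scalar_product (A *v x) z = scalar_product (A *v y) z"
      using z by (auto simp: congruence_orth_def)
    with neq show False
      by (simp only: a scalar_product_transpose)
  qed
qed

theorem proposition4:
  fixes A :: "rmax ^ 'n ^ 'n"
    and C :: "rmax ^ 'n ^ 'q"
    and V :: "((rmax ^ 'n) \<times> (rmax ^ 'n)) set"
    and K :: "(rmax ^ 'n) set"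
  assumes "congruence V"
    and "K = congruence_orth V"
  shows "(let W = semimodule_orth (max_controlled_invariant K (transpose A) (transpose C)) in
     (closed W \<and> conditioned_invariant C A W \<and> V \<subseteq> W \<and>
       (\<forall>W'. closed W' \<and> conditioned_invariant C A W' \<and> V \<subseteq> W' \<longrightarrow> W \<subseteq> W')) \<and>
     min_conditioned_invariant V C A \<subseteq> W \<and>
     (closed (min_conditioned_invariant V C A) \<longrightarrow> min_conditioned_invariant V C A = W))"
proof -
  let ?X = "max_controlled_invariant K (transpose A) (transpose C)"
  let ?W = "semimodule_orth ?X"
  have K: "subsemimodule (*s) K"
    using assms(2) subsemimodule_congruence_orth by simp
  have inv: "conditioned_invariant C A ?W"
    by (intro conditioned_invariant_semimodule_orth max_controlled_invariant_invariant K)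
  have VW: "V \<subseteq> ?W"
    using max_controlled_invariant_subset[OF K] assms(2)
    by (fastforce simp: semimodule_orth_def congruence_orth_def)
  have least: "?W \<subseteq> W'" if "closed W'" "conditioned_invariant C A W'" "V \<subseteq> W'" for W'
  proof -
    \<comment> \<open>Both orthogonals reverse inclusions. Closedness of \<open>W'\<close> enters
      twice: it makes \<open>congruence_orth W'\<close> controlled invariant, and it lets the double
      orthogonal return to \<open>W'\<close>.\<close>
    have "congruence_orth W' \<subseteq> K"
      using \<open>V \<subseteq> W'\<close> assms(2) by (auto simp: congruence_orth_def)
    then have "congruence_orth W' \<subseteq> ?X"
      using that by (intro max_controlled_invariant_greatest K controlled_invariant_congruence_orth)
    then have "?W \<subseteq> semimodule_orth (congruence_orth W')"
      by (auto simp: semimodule_orth_def)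
    also have "\<dots> = W'"
      using that by (intro semimodule_orth_congruence_orth) (auto simp: conditioned_invariant_def)
    finally show ?thesis .
  qed
  have "min_conditioned_invariant V C A \<subseteq> ?W"
    by (rule min_conditioned_invariant_least[OF inv VW])
  moreover have "?W \<subseteq> min_conditioned_invariant V C A"
    if "closed (min_conditioned_invariant V C A)"
    by (intro least that min_conditioned_invariant_invariant min_conditioned_invariant_superset)
  ultimately show ?thesis
    using closed_semimodule_orth inv VW least unfolding Let_def by blast
qed

end
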